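(* Let $C_{10}^{21},C_{01}^{21},C_{10}^{30},C_{20}^{30},C_{01}^{30},C_{11}^{30},C_{02}^{30}\in\mathbb{C}$ with $C_{02}^{30}\neq 0$, and let $\omega_{3211}^{2}$ be the $1$-form attached to the partition $\lambda(2)=(3,2,1^2)$ of $7$ and the leading terms $LT_{22}=\{yz^2,-y^2z,y^3\}$, with local representation $f\,dy+g\,dz$ at $[1:0:0]$ given by $$f=-C_{10}^{21}y-C_{01}^{21}z+C_{20}^{30}yz-y^{2}z+(C_{11}^{30}-1)z^{2},$$ $$g=-C_{10}^{30}y-C_{20}^{30}y^{2}+y^{3}-C_{01}^{30}z-C_{11}^{30}yz-C_{02}^{30}z^{2}.$$ Assume that the algebraic multiplicity satisfies $m_{[1:0:0]}(\omega_{3211}^2)=2$. Then $$4\leq I_0(f,g)\leq 7,$$ and the maximum intersection index $7$ is attained if and only if $C_{20}^{30}=0$ and $C_{11}^{30}=1$.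
   Context: The form is $\omega_{3211}^2=A\,dx+B\,dy+C\,dz$ on $\mathbb{CP}^2$, where $A,B,C\in\mathbb{C}[x,y,z]$ are homogeneous of degree $3$ with $xA+yB+zC=0$; $B,C$ are the homogenizations of $f,g$ to degree $3$ with respect to $x$ (so $f=B(1,y,z)$, $g=C(1,y,z)$), and $A$ is determined by the Euler relation. The point $[1:0:0]$ is a zero of $A,B,C$. The algebraic multiplicity $m_{[1:0:0]}(\omega)$ is $\min\{m,s\}$, where $m$ (resp. $s$) is the lowest degree of a nonzero homogeneous component of $f$ (resp. $g$). $I_0(f,g)=\dim_{\mathbb{C}}\mathcal{O}_{\mathbb{C}^2,(0,0)}/\langle f,g\rangle$ is the intersection index of $f$ and $g$ at the origin ($\infty$ if the dimension is infinite). *)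

theory Defs
  imports
    "HOL-Analysis.Infinite_Sum"
    "HOL-Computational_Algebra.Formal_Power_Series"
    "HOL-Library.Poly_Mapping"
    "HOL-Library.Product_Plus"
    "HOL-Library.Extended_Nat"
    "HOL-Algebra.QuotRing"
    "HOL-Algebra.Embedded_Algebras"
begin

text \<open>
  A polynomial is a finitely supported map from exponent vectors to coefficients:
  \<open>(j, k)\<close> stands for \<open>y^j z^k\<close> and \<open>(i, j, k)\<close> for \<open>x^i y^j z^k\<close>. With componentwise addition
  of exponents the multiplication of \<open>poly_mapping\<close> is the product of polynomials.
\<close>

type_synonym poly_yz = "(nat \<times> nat) \<Rightarrow>\<^sub>0 complex"
type_synonym poly_xyz = "(nat \<times> nat \<times> nat) \<Rightarrow>\<^sub>0 complex"

abbreviation cst :: "complex \<Rightarrow> poly_yz" where "cst c \<equiv> Poly_Mapping.single 0 c"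
abbreviation y_var :: poly_yz where "y_var \<equiv> Poly_Mapping.single (1, 0) 1"
abbreviation z_var :: poly_yz where "z_var \<equiv> Poly_Mapping.single (0, 1) 1"

abbreviation X_var :: poly_xyz where "X_var \<equiv> Poly_Mapping.single (1, 0, 0) 1"
abbreviation Y_var :: poly_xyz where "Y_var \<equiv> Poly_Mapping.single (0, 1, 0) 1"
abbreviation Z_var :: poly_xyz where "Z_var \<equiv> Poly_Mapping.single (0, 0, 1) 1"

definition homogeneous :: "nat \<Rightarrow> poly_xyz \<Rightarrow> bool" where
  "homogeneous d p \<longleftrightarrow> (\<forall>(i, j, k) \<in> Poly_Mapping.keys p. i + j + k = d)"

text \<open>Homogenization to degree \<open>d\<close> with respect to \<open>x\<close>; meant for \<open>p\<close> of degree at most \<open>d\<close>.\<close>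

definition homogenize :: "nat \<Rightarrow> poly_yz \<Rightarrow> poly_xyz" where
  "homogenize d p =
     (\<Sum>(j, k) \<in> Poly_Mapping.keys p.
        Poly_Mapping.single (d - (j + k), j, k) (Poly_Mapping.lookup p (j, k)))"

text \<open>The substitution \<open>p(1, y, z)\<close>.\<close>

definition dehomogenize :: "poly_xyz \<Rightarrow> poly_yz" where
  "dehomogenize p =
     (\<Sum>(i, j, k) \<in> Poly_Mapping.keys p.
        Poly_Mapping.single (j, k) (Poly_Mapping.lookup p (i, j, k)))"

text \<open>The triple \<open>(A, B, C)\<close> represents the 1-form \<open>A dx + B dy + C dz\<close>.\<close>

type_synonym one_form = "poly_xyz \<times> poly_xyz \<times> poly_xyz"

definition projective_form :: "nat \<Rightarrow> one_form \<Rightarrow> bool" where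
  "projective_form d \<omega> \<longleftrightarrow> (case \<omega> of (A, B, C) \<Rightarrow>
     homogeneous d A \<and> homogeneous d B \<and> homogeneous d C \<and>
     X_var * A + Y_var * B + Z_var * C = 0)"

definition homogeneous_part :: "nat \<Rightarrow> poly_yz \<Rightarrow> poly_yz" where
  "homogeneous_part d p =
     (\<Sum>(j, k) \<in> {(j, k) \<in> Poly_Mapping.keys p. j + k = d}.
        Poly_Mapping.single (j, k) (Poly_Mapping.lookup p (j, k)))"

text \<open>The value for the zero polynomial is \<open>\<infinity>\<close>.\<close>

definition lowest_degree :: "poly_yz \<Rightarrow> enat" where
  "lowest_degree p = (INF d \<in> {d. homogeneous_part d p \<noteq> 0}. enat d)"

text \<open>In the chart \<open>x = 1\<close> the form becomes \<open>B(1, y, z) dy + C(1, y, z) dz\<close>, and \<open>[1:0:0]\<close> is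
  the origin of this chart.\<close>

definition alg_multiplicity_100 :: "one_form \<Rightarrow> enat" where
  "alg_multiplicity_100 \<omega> = (case \<omega> of (A, B, C) \<Rightarrow>
     min (lowest_degree (dehomogenize B)) (lowest_degree (dehomogenize C)))"

text \<open>
  The local ring \<open>O\<close> of germs at the origin of holomorphic functions on the complex plane
  \<open>\<complex>\<^sup>2\<close> with coordinates \<open>y, z\<close>, realised as the ring \<open>\<complex>{y, z}\<close> of power series converging
  absolutely in some polydisc around the origin (a germ is identified with its Taylor series).
  In a series \<open>F\<close> the coefficient of \<open>y^j z^k\<close> is \<open>fps_nth (fps_nth F k) j\<close>.
\<close>

type_synonym series_yz = "complex fps fps"

definition convergent_series :: "series_yz set" where
  "convergent_series =
     {F. \<exists>r>0. (\<lambda>(j, k). norm (fps_nth (fps_nth F k) j) * r ^ (j + k)) summable_on UNIV}"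

definition germ_ring :: "series_yz ring" where
  "germ_ring = \<lparr>carrier = convergent_series, monoid.mult = (*), one = 1, zero = 0, add = (+)\<rparr>"

definition germ :: "poly_yz \<Rightarrow> series_yz" where
  "germ p = Abs_fps (\<lambda>k. Abs_fps (\<lambda>j. Poly_Mapping.lookup p (j, k)))"

definition intersection_ideal :: "poly_yz \<Rightarrow> poly_yz \<Rightarrow> series_yz set" where
  "intersection_ideal f g = genideal germ_ring {germ f, germ g}"

definition local_algebra :: "poly_yz \<Rightarrow> poly_yz \<Rightarrow> series_yz set ring" where
  "local_algebra f g = germ_ring Quot intersection_ideal f g"

text \<open>The copy of \<open>\<complex>\<close> in the quotient, over which the dimension is taken.\<close>

definition local_scalars :: "poly_yz \<Rightarrow> poly_yz \<Rightarrow> series_yz set set" where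
  "local_scalars f g =
     range (\<lambda>c. a_r_coset germ_ring (intersection_ideal f g) (fps_const (fps_const c)))"

text \<open>\<open>I\<^sub>0(f, g)\<close>, the complex dimension of \<open>O / \<langle>f, g\<rangle>\<close>. Here \<open>ring.dimension R n K E\<close> says that
  \<open>E\<close> is a subspace of \<open>R\<close> of finite dimension \<open>n\<close> over the subfield \<open>K\<close>; if there is no such
  \<open>n\<close>, the dimension is infinite.\<close>

definition intersection_index :: "poly_yz \<Rightarrow> poly_yz \<Rightarrow> enat" where
  "intersection_index f g =
     (let dim = (\<lambda>n. ring.dimension (local_algebra f g) n (local_scalars f g)
                       (carrier (local_algebra f g)))
      in if \<exists>n. dim n then enat (THE n. dim n) else \<infinity>)"

end

theory Submission
  imports Defs
begin

text \<open>
  With multiplicity 2 all linear terms vanish, and with \<open>a = C30_20\<close>, \<open>b = C30_11 - 1\<close>,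
  \<open>e = C30_02\<close> we get \<open>f = z h\<close>, \<open>h = a y - y\<^sup>2 + b z\<close>. Since \<open>z\<close> is prime and does not
  divide \<open>g\<close>, the index is \<open>I\<^sub>0(z, g) + I\<^sub>0(h, g)\<close>. The first summand is the order of
  \<open>-a y\<^sup>2 + y\<^sup>3\<close>. If \<open>b \<noteq> 0\<close>, then \<open>h = 0\<close> is the graph \<open>z = -y p\<close> with
  \<open>p = (a - y) / b\<close>, on which \<open>g\<close> restricts to \<open>y\<^sup>2 p (1 - e p)\<close>; if \<open>b = 0\<close>, then \<open>h\<close> is
  \<open>y\<close> times a unit or \<open>-y\<^sup>2\<close>, and \<open>I\<^sub>0(y, g) = 2\<close>. Dimensions are measured by chains of complex
  subspaces from the ideal to the whole ring in which each step adds one dimension.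
\<close>

section \<open>Convergent power series\<close>

lemma sum_geometric_half_le: "(\<Sum>i\<le>n. (1/2::real) ^ i) \<le> 2"
proof -
  have "(\<Sum>i\<le>n. (1/2::real) ^ i) = 2 - (1/2) ^ n"
    by (induction n) (simp_all add: field_simps)
  then show ?thesis by simp
qed

text \<open>Terms bounded by \<open>M\<close> at radius \<open>r\<close> are dominated at radius
  \<open>r / 2\<close> by \<open>M\<close> times a double geometric series, so all finite partial
  sums are at most \<open>4 * M\<close>. A bound on single terms is easier to propagate through
  sums, products and shifts than summability.\<close>

lemma convergent_series_iff_bounded:
  "F \<in> convergent_series \<longleftrightarrow>
     (\<exists>r>0. \<exists>M. \<forall>j k. norm (fps_nth (fps_nth F k) j) * r ^ (j + k) \<le> M)" (is "?L \<longleftrightarrow> ?R")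
proof
  assume ?L
  then obtain r where r: "r > 0"
    and s: "(\<lambda>(j, k). norm (fps_nth (fps_nth F k) j) * r ^ (j + k)) summable_on UNIV"
    by (auto simp: convergent_series_def)
  have "norm (fps_nth (fps_nth F k) j) * r ^ (j + k)
      \<le> infsum (\<lambda>(j, k). norm (fps_nth (fps_nth F k) j) * r ^ (j + k)) UNIV" for j k
    using finite_sum_le_infsum[OF s, of "{(j, k)}"] r by (auto simp: case_prod_beta)
  then show ?R using r by blast
next
  assume ?R
  then obtain r M where r: "r > 0"
    and M: "\<And>j k. norm (fps_nth (fps_nth F k) j) * r ^ (j + k) \<le> M" by blast
  let ?h = "\<lambda>(j, k). norm (fps_nth (fps_nth F k) j) * (r / 2) ^ (j + k)"
  have M0: "M \<ge> 0" using M[of 0 0] by (auto intro: order_trans[rotated])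
  have "sum ?h S \<le> 4 * M" if fin: "finite S" for S
  proof -
    obtain n where n: "\<And>j k. (j, k) \<in> S \<Longrightarrow> j \<le> n \<and> k \<le> n"
    proof -
      have "finite (fst ` S \<union> snd ` S)" using fin by simp
      then obtain n where "\<forall>x \<in> fst ` S \<union> snd ` S. x \<le> n"
        by (meson finite_nat_set_iff_bounded_le)
      then show ?thesis by (intro that[of n]) force
    qed
    have le: "?h x \<le> (case x of (j, k) \<Rightarrow> M * ((1/2) ^ j * (1/2) ^ k))" for x
    proof (cases x)
      case (Pair j k)
      have "?h x = (norm (fps_nth (fps_nth F k) j) * r ^ (j + k)) * ((1/2) ^ j * (1/2) ^ k)"
        by (simp add: Pair power_divide power_add)
      also have "\<dots> \<le> M * ((1/2) ^ j * (1/2) ^ k)"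
        by (intro mult_right_mono M) auto
      finally show ?thesis by (simp add: Pair)
    qed
    have "sum ?h S \<le> sum ?h ({..n} \<times> {..n})"
      by (intro sum_mono2) (use n r in auto)
    also have "\<dots> \<le> (\<Sum>(j, k)\<in>{..n} \<times> {..n}. M * ((1/2) ^ j * (1/2) ^ k))"
      by (intro sum_mono le)
    also have "\<dots> = M * ((\<Sum>j\<le>n. (1/2) ^ j) * (\<Sum>k\<le>n. (1/2) ^ k))"
      by (simp only: sum_product sum.cartesian_product) (simp add: sum_distrib_left case_prod_unfold)
    also have "\<dots> \<le> M * (2 * 2)"
      by (intro mult_left_mono mult_mono sum_geometric_half_le M0 sum_nonneg) auto
    finally show ?thesis by simp
  qed
  then have "bdd_above (sum ?h ` {S. S \<subseteq> UNIV \<and> finite S})"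
    by (intro bdd_aboveI[of _ "4 * M"]) auto
  then have "?h summable_on UNIV"
    by (intro nonneg_bdd_above_summable_on) (use r in auto)
  then show ?L
    using r unfolding convergent_series_def by (intro CollectI exI[of _ "r / 2"]) simp
qed

lemma convergent_seriesI:
  assumes "r > 0" "\<And>j k. norm (fps_nth (fps_nth F k) j) * r ^ (j + k) \<le> M"
  shows "F \<in> convergent_series"
  using assms convergent_series_iff_bounded by blast

text \<open>The bound is kept for every smaller radius, so that two series can be estimated on the
  smaller of their two radii.\<close>

lemma convergent_seriesE:
  assumes "F \<in> convergent_series"
  obtains r M where "r > 0" "M \<ge> 0"
    "\<And>s j k. 0 \<le> s \<Longrightarrow> s \<le> r \<Longrightarrow> norm (fps_nth (fps_nth F k) j) * s ^ (j + k) \<le> M"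
proof -
  obtain r M where r: "r > 0"
    and M: "\<And>j k. norm (fps_nth (fps_nth F k) j) * r ^ (j + k) \<le> M"
    using assms convergent_series_iff_bounded by blast
  have "norm (fps_nth (fps_nth F k) j) * s ^ (j + k) \<le> M" if "0 \<le> s" "s \<le> r" for s j k
    by (rule order_trans[OF mult_left_mono M[of k j]]) (use that in \<open>auto intro: power_mono\<close>)
  moreover have "M \<ge> 0" using M[of 0 0] by (auto intro: order_trans[rotated])
  ultimately show thesis using that r by blast
qed

lemma convergent_series_add:
  assumes "F \<in> convergent_series" "G \<in> convergent_series"
  shows "F + G \<in> convergent_series"
proof -
  obtain r M where r: "r > 0"
    and M: "\<And>s j k. 0 \<le> s \<Longrightarrow> s \<le> r \<Longrightarrow> norm (fps_nth (fps_nth F k) j) * s ^ (j + k) \<le> M"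
    using convergent_seriesE[OF assms(1)] by metis
  obtain r' N where r': "r' > 0"
    and N: "\<And>s j k. 0 \<le> s \<Longrightarrow> s \<le> r' \<Longrightarrow> norm (fps_nth (fps_nth G k) j) * s ^ (j + k) \<le> N"
    using convergent_seriesE[OF assms(2)] by metis
  define s where "s = min r r'"
  have s: "s > 0" "s \<le> r" "s \<le> r'" using r r' by (auto simp: s_def)
  show ?thesis
  proof (rule convergent_seriesI[OF s(1)])
    fix j k
    have "norm (fps_nth (fps_nth (F + G) k) j) * s ^ (j + k)
        \<le> (norm (fps_nth (fps_nth F k) j) + norm (fps_nth (fps_nth G k) j)) * s ^ (j + k)"
      using s by (intro mult_right_mono) (auto simp: norm_triangle_ineq)
    also have "\<dots> \<le> M + N"
      using M[of s k j] N[of s k j] s by (simp add: distrib_right)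
    finally show "norm (fps_nth (fps_nth (F + G) k) j) * s ^ (j + k) \<le> M + N" .
  qed
qed

lemma convergent_series_uminus:
  assumes "F \<in> convergent_series" shows "- F \<in> convergent_series"
  using assms by (simp add: convergent_series_iff_bounded)

lemma convergent_series_diff:
  "F \<in> convergent_series \<Longrightarrow> G \<in> convergent_series \<Longrightarrow> F - G \<in> convergent_series"
  using convergent_series_add[of F "- G"] convergent_series_uminus[of G] by simp

text \<open>Each coefficient of the product is a sum of \<open>(j + 1) * (k + 1)\<close> terms, each
  of size at most \<open>M * N / s ^ (j + k)\<close>. Since \<open>n + 1 \<le> 2 ^ n\<close>,
  halving the radius absorbs the number of terms.\<close>

lemma convergent_series_mult:
  assumes "F \<in> convergent_series" "G \<in> convergent_series"
  shows "F * G \<in> convergent_series"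
proof -
  obtain r M where r: "r > 0" "M \<ge> 0"
    and M: "\<And>s j k. 0 \<le> s \<Longrightarrow> s \<le> r \<Longrightarrow> norm (fps_nth (fps_nth F k) j) * s ^ (j + k) \<le> M"
    using convergent_seriesE[OF assms(1)] by metis
  obtain r' N where r': "r' > 0" "N \<ge> 0"
    and N: "\<And>s j k. 0 \<le> s \<Longrightarrow> s \<le> r' \<Longrightarrow> norm (fps_nth (fps_nth G k) j) * s ^ (j + k) \<le> N"
    using convergent_seriesE[OF assms(2)] by metis
  define s where "s = min r r'"
  have s: "s > 0" "s \<le> r" "s \<le> r'" using r r' by (auto simp: s_def)
  have suc_le: "real (Suc n) \<le> 2 ^ n" for n
    by (metis Suc_leI less_exp of_nat_le_iff of_nat_numeral of_nat_power)
  show ?thesis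
  proof (rule convergent_seriesI[of "s / 2"])
    show "s / 2 > 0" using s by simp
    fix j k
    let ?t = "\<lambda>l i. norm (fps_nth (fps_nth F l) i) * norm (fps_nth (fps_nth G (k - l)) (j - i))"
    have t: "?t l i * s ^ (j + k) \<le> M * N" if "l \<le> k" "i \<le> j" for l i
    proof -
      have "s ^ (j + k) = s ^ (i + l) * s ^ ((j - i) + (k - l))"
        using that by (simp flip: power_add)
      then have "?t l i * s ^ (j + k) = (norm (fps_nth (fps_nth F l) i) * s ^ (i + l))
          * (norm (fps_nth (fps_nth G (k - l)) (j - i)) * s ^ ((j - i) + (k - l)))"
        by simp
      also have "\<dots> \<le> M * N"
        by (intro mult_mono M N) (use s r in auto)
      finally show ?thesis .
    qed
    have "norm (fps_nth (fps_nth (F * G) k) j) \<le> (\<Sum>l=0..k. \<Sum>i=0..j. ?t l i)"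
      by (simp add: fps_mult_nth fps_sum_nth)
         (intro order_trans[OF norm_sum] sum_mono, simp add: norm_mult)
    then have "norm (fps_nth (fps_nth (F * G) k) j) * s ^ (j + k)
        \<le> (\<Sum>l=0..k. \<Sum>i=0..j. ?t l i) * s ^ (j + k)"
      using s by (intro mult_right_mono) auto
    also have "\<dots> = (\<Sum>l=0..k. \<Sum>i=0..j. ?t l i * s ^ (j + k))"
      by (simp add: sum_distrib_right)
    also have "\<dots> \<le> (\<Sum>l=0..k. \<Sum>i=0..j. M * N)"
      by (intro sum_mono t) auto
    also have "\<dots> = real (Suc j) * real (Suc k) * (M * N)"
      by simp
    also have "\<dots> \<le> (2 ^ j * 2 ^ k) * (M * N)"
      using r r' by (intro mult_right_mono mult_mono suc_le) auto
    finally have "norm (fps_nth (fps_nth (F * G) k) j) * s ^ (j + k) \<le> 2 ^ (j + k) * (M * N)"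
      by (simp add: power_add)
    then show "norm (fps_nth (fps_nth (F * G) k) j) * (s / 2) ^ (j + k) \<le> M * N"
      by (simp add: power_divide field_simps)
  qed
qed

section \<open>Scalars and coordinate functions as series\<close>

definition const :: "complex \<Rightarrow> series_yz" where "const c = fps_const (fps_const c)"
text \<open>The outer variable of the nested series is \<open>z\<close> and the inner one is
  \<open>y\<close>; hence \<open>y\<close> is a constant of the outer series.\<close>

definition Y :: series_yz where "Y = fps_const fps_X"
definition Z :: series_yz where "Z = fps_X"

lemma const_simps:
  "const 0 = 0" "const 1 = 1" "const (a + b) = const a + const b"
  "const (a - b) = const a - const b" "const (- a) = - const a" "const (a * b) = const a * const b"
  by (simp_all add: const_def fps_const_add [symmetric] fps_const_sub [symmetric]
      fps_const_neg [symmetric] fps_const_mult [symmetric]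
      del: fps_const_add fps_const_sub fps_const_neg fps_const_mult)

lemma convergent_series_const: "const c \<in> convergent_series"
  by (rule convergent_seriesI[of 1 _ "norm c"]) (auto simp: const_def)

lemma convergent_series_0: "0 \<in> convergent_series"
  and convergent_series_1: "1 \<in> convergent_series"
  using convergent_series_const[of 0] convergent_series_const[of 1] by (simp_all add: const_simps)

lemma convergent_series_Y: "Y \<in> convergent_series"
  by (rule convergent_seriesI[of 1 _ 1]) (auto simp: Y_def fps_X_def)

lemma convergent_series_Z: "Z \<in> convergent_series"
  by (rule convergent_seriesI[of 1 _ 1]) (auto simp: Z_def fps_X_def)

lemma convergent_series_power: "F \<in> convergent_series \<Longrightarrow> F ^ n \<in> convergent_series"
  by (induction n) (auto intro: convergent_series_1 convergent_series_mult)

lemmas convergent_series_closed = convergent_series_add convergent_series_uminus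
  convergent_series_diff convergent_series_mult convergent_series_power convergent_series_const
  convergent_series_0 convergent_series_1 convergent_series_Y convergent_series_Z

section \<open>Units and divisibility by the coordinates\<close>

lemma linear_unit:
  assumes "c \<noteq> 0"
  shows "\<exists>u \<in> convergent_series. (const c + const d * Y) * u = 1"
proof -
  \<comment> \<open>With this \<open>q\<close> one has \<open>c + d y = c (1 - q y)\<close>, and the
    inverse of \<open>1 - q y\<close> is the geometric series in \<open>q y\<close>.\<close>
  define q where "q = - d / c"
  define u where "u = fps_const (Abs_fps (\<lambda>j. q ^ j))"
  have "u \<in> convergent_series"
  \<comment> \<open>The summand 1 in the denominator keeps the radius meaningful for
    \<open>q = 0\<close>.\<close>
  proof (rule convergent_seriesI[of "1 / (norm q + 1)" _ 1])
    show "1 / (norm q + 1) > 0" by (simp add: add_nonneg_pos)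
    fix j k
    have "(norm q / (norm q + 1)) ^ j \<le> 1"
      by (intro power_le_one) (auto simp: divide_le_eq_1 add_nonneg_pos)
    then show "norm (fps_nth (fps_nth u k) j) * (1 / (norm q + 1)) ^ (j + k) \<le> 1"
      by (cases "k = 0") (auto simp: u_def norm_power power_divide)
  qed
  moreover have "(1 - fps_const q * fps_X) * Abs_fps (\<lambda>j. q ^ j) = 1"
  proof (rule fps_ext)
    fix n show "fps_nth ((1 - fps_const q * fps_X) * Abs_fps (\<lambda>j. q ^ j)) n = fps_nth 1 n"
      by (cases n) (simp_all add: left_diff_distrib mult.assoc)
  qed
  then have "(1 - const q * Y) * u = 1"
    by (simp add: const_def Y_def u_def fps_const_mult fps_const_sub flip: fps_const_1_eq_1)
  moreover have "const c + const d * Y = const c * (1 - const q * Y)"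
  proof -
    have "d = - (c * q)" using assms by (simp add: q_def)
    then show ?thesis by (simp add: const_simps algebra_simps)
  qed
  ultimately have "(const c + const d * Y) * (const (inverse c) * u) = const (c * inverse c)"
    by (metis (no_types, lifting) const_simps(6) mult.assoc mult.left_commute mult.right_neutral)
  then show ?thesis
    using assms \<open>u \<in> convergent_series\<close>
    by (intro bexI[of _ "const (inverse c) * u"]) (auto simp: const_simps convergent_series_closed)
qed

text \<open>Division by \<open>z\<close> shifts the coefficients; the shifted series is bounded by
  \<open>M / r\<close> at the same radius, so the quotient converges. The condition on the right is
  that \<open>F\<close> vanishes on the line \<open>z = 0\<close>.\<close>

lemma Z_dvd_iff:
  assumes "F \<in> convergent_series"
  shows "(\<exists>G \<in> convergent_series. F = Z * G) \<longleftrightarrow> fps_nth F 0 = 0"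
proof
  assume F0: "fps_nth F 0 = 0"
  obtain r M where r: "r > 0"
    and M: "\<And>s j k. 0 \<le> s \<Longrightarrow> s \<le> r \<Longrightarrow> norm (fps_nth (fps_nth F k) j) * s ^ (j + k) \<le> M"
    using convergent_seriesE[OF assms] by metis
  have "Abs_fps (\<lambda>k. fps_nth F (Suc k)) \<in> convergent_series"
  proof (rule convergent_seriesI[OF r])
    fix j k
    show "norm (fps_nth (fps_nth (Abs_fps (\<lambda>k. fps_nth F (Suc k))) k) j) * r ^ (j + k) \<le> M / r"
      using M[of r "Suc k" j] r by (simp add: field_simps)
  qed
  moreover have "F = Z * Abs_fps (\<lambda>k. fps_nth F (Suc k))"
    using F0 by (intro fps_ext) (simp add: Z_def)
  ultimately show "\<exists>G \<in> convergent_series. F = Z * G" by blast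
qed (auto simp: Z_def)

lemma Y_dvd_iff:
  assumes "F \<in> convergent_series"
  shows "(\<exists>G \<in> convergent_series. F = Y * G) \<longleftrightarrow> (\<forall>k. fps_nth (fps_nth F k) 0 = 0)"
proof
  assume F0: "\<forall>k. fps_nth (fps_nth F k) 0 = 0"
  let ?G = "Abs_fps (\<lambda>k. Abs_fps (\<lambda>j. fps_nth (fps_nth F k) (Suc j)))"
  obtain r M where r: "r > 0"
    and M: "\<And>s j k. 0 \<le> s \<Longrightarrow> s \<le> r \<Longrightarrow> norm (fps_nth (fps_nth F k) j) * s ^ (j + k) \<le> M"
    using convergent_seriesE[OF assms] by metis
  have "?G \<in> convergent_series"
  proof (rule convergent_seriesI[OF r])
    fix j k
    show "norm (fps_nth (fps_nth ?G k) j) * r ^ (j + k) \<le> M / r"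
      using M[of r k "Suc j"] r by (simp add: field_simps)
  qed
  moreover have "F = Y * ?G"
    using F0 by (intro fps_ext) (simp add: Y_def)
  ultimately show "\<exists>G \<in> convergent_series. F = Y * G" by blast
qed (auto simp: Y_def)

text \<open>The restriction to the line \<open>y = 0\<close>, a series in \<open>z\<close>.\<close>

definition restrict_Y0 :: "series_yz \<Rightarrow> complex fps" where
  "restrict_Y0 F = Abs_fps (\<lambda>k. fps_nth (fps_nth F k) 0)"

lemma restrict_Y0_mult: "restrict_Y0 (F * G) = restrict_Y0 F * restrict_Y0 G"
  by (rule fps_ext) (simp add: restrict_Y0_def fps_mult_nth fps_sum_nth)

text \<open>This says that multiplication by \<open>g\<close> is injective on
  \<open>O / (t)\<close>, the condition that makes colengths additive in the factor
  \<open>t\<close>.\<close>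

definition coprime_mod :: "series_yz \<Rightarrow> series_yz \<Rightarrow> bool" where
  "coprime_mod t g \<longleftrightarrow> (\<forall>q \<in> convergent_series. (\<exists>G \<in> convergent_series. g * q = t * G) \<longrightarrow>
     (\<exists>G \<in> convergent_series. q = t * G))"

text \<open>Restriction to \<open>z = 0\<close> is multiplicative and one-variable series form a
  domain: if \<open>g * q\<close> vanishes on the line and \<open>g\<close> does not, then
  \<open>q\<close> does.\<close>

lemma coprime_mod_Z:
  assumes "g \<in> convergent_series" "fps_nth g 0 \<noteq> 0"
  shows "coprime_mod Z g"
  unfolding coprime_mod_def using assms by (auto simp: Z_dvd_iff convergent_series_closed)

lemma coprime_mod_Y:
  assumes "g \<in> convergent_series" "restrict_Y0 g \<noteq> 0"
  shows "coprime_mod Y g"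
proof -
  have *: "(\<exists>G \<in> convergent_series. F = Y * G) \<longleftrightarrow> restrict_Y0 F = 0"
    if "F \<in> convergent_series" for F
    unfolding Y_dvd_iff[OF that] by (auto simp: restrict_Y0_def fps_eq_iff)
  show ?thesis
    unfolding coprime_mod_def using assms
    by (auto simp: * convergent_series_closed restrict_Y0_mult)
qed

section \<open>Chains of subspaces\<close>

definition subspace_yz :: "series_yz set \<Rightarrow> bool" where
  "subspace_yz V \<longleftrightarrow> V \<subseteq> convergent_series \<and> 0 \<in> V \<and>
     (\<forall>F \<in> V. \<forall>G \<in> V. F + G \<in> V) \<and> (\<forall>c. \<forall>F \<in> V. const c * F \<in> V)"

lemma subspace_yz_diff:
  assumes "subspace_yz V" "F \<in> V" "G \<in> V"
  shows "F - G \<in> V"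
proof -
  have "F + const (-1) * G \<in> V"
    using assms unfolding subspace_yz_def by blast
  then show ?thesis by (simp add: const_simps)
qed

definition adjoin :: "series_yz \<Rightarrow> series_yz set \<Rightarrow> series_yz set" where
  "adjoin v V = {const c * v + F | c F. F \<in> V}"

lemma subspace_yz_adjoin:
  assumes "subspace_yz V" "v \<in> convergent_series"
  shows "subspace_yz (adjoin v V)" and "V \<subseteq> adjoin v V"
proof -
  have V: "V \<subseteq> convergent_series" "0 \<in> V" "\<And>F G. F \<in> V \<Longrightarrow> G \<in> V \<Longrightarrow> F + G \<in> V"
    "\<And>c F. F \<in> V \<Longrightarrow> const c * F \<in> V"
    using assms(1) by (auto simp: subspace_yz_def)
  show incl: "V \<subseteq> adjoin v V"
  proof
    fix F assume "F \<in> V"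
    then show "F \<in> adjoin v V"
      unfolding adjoin_def by (intro CollectI exI[of _ "0::complex"] exI[of _ F]) (simp add: const_simps)
  qed
  show "subspace_yz (adjoin v V)"
    unfolding subspace_yz_def
  proof (intro conjI ballI allI)
    show "adjoin v V \<subseteq> convergent_series"
      using V(1) assms(2) by (auto simp: adjoin_def intro!: convergent_series_closed)
    show "0 \<in> adjoin v V" using incl V(2) by blast
  next
    fix F G assume "F \<in> adjoin v V" "G \<in> adjoin v V"
    then obtain c F' d G' where "F = const c * v + F'" "G = const d * v + G'" "F' \<in> V" "G' \<in> V"
      by (auto simp: adjoin_def)
    then show "F + G \<in> adjoin v V"
      unfolding adjoin_def
      by (intro CollectI exI[of _ "c + d"] exI[of _ "F' + G'"])
         (simp add: const_simps algebra_simps V(3))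
  next
    fix c F assume "F \<in> adjoin v V"
    then obtain d F' where "F = const d * v + F'" "F' \<in> V" by (auto simp: adjoin_def)
    then show "const c * F \<in> adjoin v V"
      unfolding adjoin_def
      by (intro CollectI exI[of _ "c * d"] exI[of _ "const c * F'"])
         (simp add: const_simps distrib_left mult.assoc V(4))
  qed
qed

text \<open>For a subspace \<open>I\<close> the relation stands for dim \<open>V / I\<close> =
  \<open>n\<close>. Chains are used because \<open>ring.dimension\<close> is also generated by line
  extensions, so a chain projects step by step to the quotient.\<close>

inductive filtration :: "series_yz set \<Rightarrow> nat \<Rightarrow> series_yz set \<Rightarrow> bool" for I where
  filtration_0: "filtration I 0 I"
| filtration_Suc: "filtration I n V \<Longrightarrow> v \<in> convergent_series \<Longrightarrow> v \<notin> V \<Longrightarrow>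
    filtration I (Suc n) (adjoin v V)"

lemma filtration_subspace:
  assumes "filtration I n V" "subspace_yz I"
  shows "subspace_yz V" and "I \<subseteq> V"
proof -
  have "subspace_yz V \<and> I \<subseteq> V"
    using assms
  proof induction
    case (filtration_Suc n V v)
    then show ?case
      using subspace_yz_adjoin[of V v] by blast
  qed simp
  then show "subspace_yz V" and "I \<subseteq> V" by auto
qed

text \<open>The two chains are concatenated at \<open>V\<close>; this is the additivity of
  dimensions of successive quotients.\<close>

lemma filtration_trans:
  assumes "filtration V n W" "filtration I m V"
  shows "filtration I (m + n) W"
  using assms by induction (auto intro: filtration_Suc)

section \<open>Ideals with two generators\<close>

definition ideal2 :: "series_yz \<Rightarrow> series_yz \<Rightarrow> series_yz set" where
  "ideal2 u v = {p * u + q * v | p q. p \<in> convergent_series \<and> q \<in> convergent_series}"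

lemma ideal2I:
  "p \<in> convergent_series \<Longrightarrow> q \<in> convergent_series \<Longrightarrow> F = p * u + q * v \<Longrightarrow> F \<in> ideal2 u v"
  by (auto simp: ideal2_def)

lemma ideal2E:
  assumes "F \<in> ideal2 u v"
  obtains p q where "p \<in> convergent_series" "q \<in> convergent_series" "F = p * u + q * v"
  using assms by (auto simp: ideal2_def)

lemma ideal2_add:
  assumes "F \<in> ideal2 u v" "G \<in> ideal2 u v"
  shows "F + G \<in> ideal2 u v"
proof -
  obtain p q where F: "p \<in> convergent_series" "q \<in> convergent_series" "F = p * u + q * v"
    using assms(1) by (rule ideal2E)
  obtain p' q' where G: "p' \<in> convergent_series" "q' \<in> convergent_series" "G = p' * u + q' * v"
    using assms(2) by (rule ideal2E)
  show ?thesis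
    by (rule ideal2I[of "p + p'" "q + q'"])
       (auto simp: F G algebra_simps intro: convergent_series_add)
qed

lemma ideal2_mult:
  assumes "h \<in> convergent_series" "F \<in> ideal2 u v"
  shows "h * F \<in> ideal2 u v"
proof -
  obtain p q where F: "p \<in> convergent_series" "q \<in> convergent_series" "F = p * u + q * v"
    using assms(2) by (rule ideal2E)
  show ?thesis
    by (rule ideal2I[of "h * p" "h * q"])
       (auto simp: F assms algebra_simps intro: convergent_series_mult)
qed

lemma ideal2_commute: "ideal2 u v = ideal2 v u"
proof (intro equalityI subsetI)
  fix F assume "F \<in> ideal2 u v"
  then show "F \<in> ideal2 v u" by (auto elim!: ideal2E intro: ideal2I add.commute)
next
  fix F assume "F \<in> ideal2 v u"
  then show "F \<in> ideal2 u v" by (auto elim!: ideal2E intro: ideal2I add.commute)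
qed

lemma subspace_yz_ideal2:
  assumes "u \<in> convergent_series" "v \<in> convergent_series"
  shows "subspace_yz (ideal2 u v)"
  unfolding subspace_yz_def
proof (intro conjI ballI allI)
  show "ideal2 u v \<subseteq> convergent_series"
    using assms by (auto simp: ideal2_def intro!: convergent_series_closed)
  show "0 \<in> ideal2 u v" by (rule ideal2I[of 0 0]) (auto simp: convergent_series_closed)
qed (auto intro: ideal2_add ideal2_mult convergent_series_const)

lemma ideal2_subset:
  assumes "u \<in> ideal2 u' v'" "v \<in> ideal2 u' v'"
  shows "ideal2 u v \<subseteq> ideal2 u' v'"
proof
  fix F assume "F \<in> ideal2 u v"
  then obtain p q where "p \<in> convergent_series" "q \<in> convergent_series" "F = p * u + q * v"
    by (auto simp: ideal2_def)
  then show "F \<in> ideal2 u' v'" using assms by (auto intro: ideal2_add ideal2_mult)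
qed

text \<open>Two elementary operations on generators in one statement: \<open>u = v = 1\<close> gives
  the addition of a multiple of the first generator to the second, and \<open>p = 0\<close>,
  \<open>v = 1\<close> gives the scaling of the first by a unit.\<close>

lemma ideal2_cong:
  assumes "u \<in> convergent_series" "v \<in> convergent_series" "p \<in> convergent_series"
    "u' \<in> convergent_series" "u * u' = 1"
  shows "ideal2 (u * F) (p * F + v * G) = ideal2 F (v * G)"
proof (intro equalityI ideal2_subset)
  show "u * F \<in> ideal2 F (v * G)" "p * F + v * G \<in> ideal2 F (v * G)"
    using assms by (auto intro: ideal2I[of u 0] ideal2I[of p 1] convergent_series_closed)
  have F: "F = u' * (u * F)" by (metis assms(5) mult.assoc mult.commute mult_1)
  show "F \<in> ideal2 (u * F) (p * F + v * G)"
    by (rule ideal2I[of u' 0]) (use F in \<open>auto simp: convergent_series_closed assms\<close>)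
  show "v * G \<in> ideal2 (u * F) (p * F + v * G)"
  proof (rule ideal2I[of "- p * u'" 1])
    show "v * G = - p * u' * (u * F) + 1 * (p * F + v * G)"
      using F by (simp add: mult.assoc)
  qed (auto simp: convergent_series_closed assms)
qed

text \<open>This expresses dim \<open>O / (u, v)\<close> = \<open>n\<close>. It is a relation;
  uniqueness of \<open>n\<close> is settled only after the passage to
  \<open>ring.dimension\<close>.\<close>

definition colength :: "series_yz \<Rightarrow> series_yz \<Rightarrow> nat \<Rightarrow> bool" where
  "colength u v n \<longleftrightarrow> filtration (ideal2 u v) n convergent_series"

lemma colength_commute: "colength u v n \<longleftrightarrow> colength v u n"
  by (simp add: colength_def ideal2_commute)

lemma colength_add_multiple:
  assumes "p \<in> convergent_series" shows "colength u (p * u + v) n \<longleftrightarrow> colength u v n"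
  using ideal2_cong[of 1 1 p 1 u v] assms
  by (simp add: colength_def convergent_series_closed)

lemma colength_unit:
  assumes "w \<in> convergent_series" "w' \<in> convergent_series" "w * w' = 1"
  shows "colength (w * u) v n \<longleftrightarrow> colength u v n"
  using ideal2_cong[of w 1 0 w' u v] assms
  by (simp add: colength_def convergent_series_closed)

text \<open>Multiplication by \<open>t\<close> carries a chain from \<open>(s, g)\<close> to \<open>O\<close> to a chain from \<open>(t s, g)\<close> to
  \<open>(t, g)\<close>.\<close>

lemma filtration_mult:
  assumes "filtration (ideal2 s g) n V"
    and "s \<in> convergent_series" "t \<in> convergent_series" "g \<in> convergent_series"
    and "coprime_mod t g" "t \<noteq> 0"
  shows "filtration (ideal2 (t * s) g) n {t * F + q * g | F q. F \<in> V \<and> q \<in> convergent_series}"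
  using assms(1)
proof induction
  case filtration_0
  have "{t * F + q * g | F q. F \<in> ideal2 s g \<and> q \<in> convergent_series} = ideal2 (t * s) g"
  proof (intro equalityI subsetI)
    fix G assume "G \<in> {t * F + q * g | F q. F \<in> ideal2 s g \<and> q \<in> convergent_series}"
    then obtain p p' q where "G = t * (p * s + p' * g) + q * g"
      "p \<in> convergent_series" "p' \<in> convergent_series" "q \<in> convergent_series"
      by (auto simp: ideal2_def)
    then show "G \<in> ideal2 (t * s) g"
      by (intro ideal2I[of p "t * p' + q"])
         (auto simp: algebra_simps intro!: convergent_series_closed assms)
  next
    fix G assume "G \<in> ideal2 (t * s) g"
    then obtain p q where G: "G = p * (t * s) + q * g"
      "p \<in> convergent_series" "q \<in> convergent_series"
      by (auto simp: ideal2_def)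
    have "p * s \<in> ideal2 s g"
      by (rule ideal2I[of p 0]) (auto simp: G convergent_series_closed)
    then show "G \<in> {t * F + q * g | F q. F \<in> ideal2 s g \<and> q \<in> convergent_series}"
      using G by (intro CollectI exI[of _ "p * s"] exI[of _ q]) (simp add: algebra_simps)
  qed
  then show ?case using filtration.filtration_0 by simp
next
  case (filtration_Suc n V v)
  let ?W = "\<lambda>V. {t * F + q * g | F q. F \<in> V \<and> q \<in> convergent_series}"
  have V: "subspace_yz V" "ideal2 s g \<subseteq> V"
    using filtration_subspace[OF filtration_Suc(1)] subspace_yz_ideal2 assms by auto
  \<comment> \<open>Injectivity of multiplication by \<open>t\<close> modulo \<open>g\<close>: from
    \<open>t v = t F + q g\<close> it follows that \<open>t\<close> divides \<open>g q\<close>,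
    hence \<open>q = t q'\<close>. Cancelling \<open>t\<close> gives \<open>v = F + q' g\<close>,
    which lies in \<open>V\<close>.\<close>
  have "t * v \<notin> ?W V"
  proof
    assume "t * v \<in> ?W V"
    then obtain F q where F: "t * v = t * F + q * g" "F \<in> V" and q: "q \<in> convergent_series"
      by auto
    then have "g * q = t * (v - F)" by (simp add: algebra_simps)
    moreover have "v - F \<in> convergent_series"
      using F V filtration_Suc by (auto simp: subspace_yz_def intro: convergent_series_diff)
    ultimately obtain q' where q': "q' \<in> convergent_series" "q = t * q'"
      using assms(5) q unfolding coprime_mod_def by metis
    then have "t * v = t * (F + q' * g)" using F by (simp add: algebra_simps)
    then have "v = F + q' * g" using assms(6) by simp
    moreover have "q' * g \<in> V"
      using V(2) q' by (auto intro!: ideal2I[of 0 q'] simp: convergent_series_closed)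
    ultimately show False
      using V(1) F filtration_Suc by (auto simp: subspace_yz_def)
  qed
  then have "filtration (ideal2 (t * s) g) (Suc n) (adjoin (t * v) (?W V))"
    using filtration_Suc assms
    by (intro filtration.filtration_Suc) (auto intro: convergent_series_closed)
  \<comment> \<open>The new scalar multiple of \<open>v\<close> can be moved into or out of the
    factor multiplied by \<open>t\<close>, so the extended chain again has the required
    shape.\<close>
  also have "adjoin (t * v) (?W V) = ?W (adjoin v V)"
  proof (intro equalityI subsetI)
    fix G assume "G \<in> adjoin (t * v) (?W V)"
    then obtain c F q where G: "G = const c * (t * v) + (t * F + q * g)" "F \<in> V"
      "q \<in> convergent_series"
      by (auto simp: adjoin_def)
    then have "G = t * (const c * v + F) + q * g" by (simp add: algebra_simps)
    then show "G \<in> ?W (adjoin v V)"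
      using G unfolding adjoin_def by blast
  next
    fix G assume "G \<in> ?W (adjoin v V)"
    then obtain c F q where G: "G = t * (const c * v + F) + q * g" "F \<in> V" "q \<in> convergent_series"
      by (auto simp: adjoin_def)
    then have "G = const c * (t * v) + (t * F + q * g)" by (simp add: algebra_simps)
    then show "G \<in> adjoin (t * v) (?W V)"
      using G unfolding adjoin_def by blast
  qed
  finally show ?case .
qed

text \<open>The chain runs from \<open>(t s, g)\<close> through \<open>(t, g)\<close> to
  \<open>O\<close>. Its lower part is the image under \<open>t\<close> of a chain for
  \<open>(s, g)\<close>, its upper part a chain for \<open>(t, g)\<close>.\<close>

lemma colength_mult:
  assumes "colength s g m" "colength t g n"
    and "s \<in> convergent_series" "t \<in> convergent_series" "g \<in> convergent_series"
    and "coprime_mod t g" "t \<noteq> 0"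
  shows "colength (t * s) g (m + n)"
proof -
  have "filtration (ideal2 (t * s) g) m
      {t * F + q * g | F q. F \<in> convergent_series \<and> q \<in> convergent_series}"
    using filtration_mult[OF _ assms(3-7)] assms(1) by (simp add: colength_def)
  also have "{t * F + q * g | F q. F \<in> convergent_series \<and> q \<in> convergent_series} = ideal2 t g"
    by (simp add: ideal2_def mult.commute)
  finally show ?thesis
    using assms(2) filtration_trans unfolding colength_def by blast
qed

section \<open>Base cases of the colength\<close>

lemma colength_1: "g \<in> convergent_series \<Longrightarrow> colength 1 g 0"
proof -
  assume g: "g \<in> convergent_series"
  have "F \<in> ideal2 1 g" if "F \<in> convergent_series" for F
    using that by (intro ideal2I[of F 0]) (auto simp: convergent_series_closed)
  then have "ideal2 1 g = convergent_series"
    using subspace_yz_ideal2[of 1 g] g by (auto simp: subspace_yz_def convergent_series_closed)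
  then show ?thesis by (simp add: colength_def filtration_0)
qed

text \<open>The ideal \<open>(y, z)\<close> is the kernel of evaluation at the origin: F = F(0,0) +
  (F(y,0) - F(0,0)) + (F - F(y,0)), where the second summand is divisible by \<open>y\<close> and
  the third by \<open>z\<close>.\<close>

lemma colength_Y_Z: "colength Y Z 1"
proof -
  have 1: "1 \<notin> ideal2 Y Z"
  proof
    assume "1 \<in> ideal2 Y Z"
    then obtain p q where "1 = p * Y + q * Z" by (auto simp: ideal2_def)
    then have "fps_nth (fps_nth 1 0) 0 = fps_nth (fps_nth (p * Y + q * Z) 0) 0" by simp
    then show False by (simp add: Y_def Z_def)
  qed
  have "adjoin 1 (ideal2 Y Z) = convergent_series"
  proof
    show "adjoin 1 (ideal2 Y Z) \<subseteq> convergent_series"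
      using subspace_yz_adjoin(1)[OF subspace_yz_ideal2]
      by (simp add: subspace_yz_def convergent_series_closed)
    show "convergent_series \<subseteq> adjoin 1 (ideal2 Y Z)"
    proof
      fix F assume F: "F \<in> convergent_series"
      let ?c = "fps_nth (fps_nth F 0) 0"
      let ?r = "fps_const (fps_nth F 0)"
      obtain r M where r: "r > 0" "M \<ge> 0" and
        M: "\<And>s j k. 0 \<le> s \<Longrightarrow> s \<le> r \<Longrightarrow> norm (fps_nth (fps_nth F k) j) * s ^ (j + k) \<le> M"
        using convergent_seriesE[OF F] by metis
      have rO: "?r \<in> convergent_series"
      proof (rule convergent_seriesI[OF r(1)])
        fix j k
        show "norm (fps_nth (fps_nth ?r k) j) * r ^ (j + k) \<le> M"
          using M[of r 0 j] r by (cases "k = 0") auto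
      qed
      obtain q where q: "q \<in> convergent_series" "F - ?r = Z * q"
        using Z_dvd_iff[of "F - ?r"] F rO by (auto simp: convergent_series_closed)
      obtain p where p: "p \<in> convergent_series" "?r - const ?c = Y * p"
        using Y_dvd_iff[THEN iffD2, OF convergent_series_diff[OF rO convergent_series_const]]
        by (force simp: const_def)
      have "F = const ?c * 1 + (p * Y + q * Z)"
        using p q by (simp add: algebra_simps)
      then show "F \<in> adjoin 1 (ideal2 Y Z)"
        using p q unfolding adjoin_def ideal2_def by blast
    qed
  qed
  then show ?thesis
    using filtration_Suc[OF filtration_0 convergent_series_1 1] by (simp add: colength_def)
qed

lemma Y_Z_neq_0: "Y \<noteq> 0" "Z \<noteq> 0"
  by (simp_all add: Y_def Z_def)

text \<open>The curve \<open>z = - p y\<close> is a graph over the \<open>y\<close>-axis, so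
  \<open>y\<close> is a local parameter on it and \<open>y ^ m\<close> has order \<open>m\<close>.
  Each factor \<open>y\<close> contributes 1, because \<open>(y, p y + z) = (y, z)\<close>.\<close>

lemma colength_Y_power:
  assumes "p \<in> convergent_series"
  shows "colength (Y ^ m) (p * Y + Z) m"
proof (induction m)
  case 0
  then show ?case using assms by (auto intro!: colength_1 convergent_series_closed)
next
  case (Suc m)
  have "restrict_Y0 (p * Y + Z) = fps_X"
    by (rule fps_ext) (simp add: restrict_Y0_def Y_def Z_def fps_X_def)
  then have "coprime_mod Y (p * Y + Z)"
    by (intro coprime_mod_Y) (auto intro: convergent_series_closed assms)
  moreover have "colength Y (p * Y + Z) 1"
    using colength_Y_Z assms by (simp add: colength_add_multiple)
  ultimately have "colength (Y * Y ^ m) (p * Y + Z) (m + 1)"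
    by (intro colength_mult Suc) (auto intro: convergent_series_closed assms simp: Y_Z_neq_0)
  then show ?case by simp
qed

lemma colength_Z_square: "colength (Z ^ 2) Y 2"
proof -
  have "coprime_mod Z Y"
    by (intro coprime_mod_Z convergent_series_Y) (simp add: Y_def)
  then have "colength (Z * Z) Y (1 + 1)"
    using colength_Y_Z by (intro colength_mult) (auto simp: colength_commute Y_Z_neq_0 convergent_series_closed)
  then show ?thesis by (simp only: power2_eq_square one_add_one)
qed

section \<open>The dimension of the quotient\<close>

lemma germ_ring_simps [simp]:
  "carrier germ_ring = convergent_series" "x \<otimes>\<^bsub>germ_ring\<^esub> y = x * y" "x \<oplus>\<^bsub>germ_ring\<^esub> y = x + y"
  "\<one>\<^bsub>germ_ring\<^esub> = 1" "\<zero>\<^bsub>germ_ring\<^esub> = 0"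
  by (simp_all add: germ_ring_def)

lemma cring_germ_ring: "cring germ_ring"
proof (rule cringI)
  show "abelian_group germ_ring"
  proof (rule abelian_groupI)
    fix x assume "x \<in> carrier germ_ring"
    then show "\<exists>y \<in> carrier germ_ring. y \<oplus>\<^bsub>germ_ring\<^esub> x = \<zero>\<^bsub>germ_ring\<^esub>"
      by (intro bexI[of _ "- x"]) (auto intro: convergent_series_uminus)
  qed (auto simp: convergent_series_closed add_ac)
  show "Group.comm_monoid germ_ring"
    by (rule comm_monoidI) (auto simp: convergent_series_closed mult_ac)
qed (simp add: distrib_right)

lemma a_inv_germ_ring: "x \<in> convergent_series \<Longrightarrow> \<ominus>\<^bsub>germ_ring\<^esub> x = - x"
proof -
  interpret cring germ_ring by (rule cring_germ_ring)
  assume "x \<in> convergent_series"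
  then show ?thesis
    using minus_equality[of "- x" x] by (simp add: convergent_series_uminus)
qed

lemma ideal_ideal2:
  assumes "u \<in> convergent_series" "v \<in> convergent_series"
  shows "ideal (ideal2 u v) germ_ring"
proof -
  interpret cring germ_ring by (rule cring_germ_ring)
  note V = subspace_yz_ideal2[OF assms]
  show ?thesis
  proof (rule idealI)
    show "ring germ_ring" by (rule ring_axioms)
    show "subgroup (ideal2 u v) (add_monoid germ_ring)"
    proof (rule add.subgroupI)
      show "ideal2 u v \<noteq> {}" using V by (auto simp: subspace_yz_def)
      show "ideal2 u v \<subseteq> carrier germ_ring" using V by (auto simp: subspace_yz_def)
      fix F assume F: "F \<in> ideal2 u v"
      then have "F \<in> convergent_series" using V by (auto simp: subspace_yz_def)
      moreover have "0 - F \<in> ideal2 u v"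
        by (rule subspace_yz_diff[OF V]) (use V F in \<open>auto simp: subspace_yz_def\<close>)
      ultimately show "\<ominus>\<^bsub>germ_ring\<^esub> F \<in> ideal2 u v" by (simp add: a_inv_germ_ring)
    qed (auto intro: ideal2_add)
    show "F \<otimes>\<^bsub>germ_ring\<^esub> G \<in> ideal2 u v" if "F \<in> ideal2 u v" "G \<in> carrier germ_ring" for F G
      using ideal2_mult[of G F u v] that by (simp add: mult.commute)
  qed (simp add: ideal2_mult)
qed

lemma genideal_germ_ring:
  assumes "u \<in> convergent_series" "v \<in> convergent_series"
  shows "genideal germ_ring {u, v} = ideal2 u v"
proof
  interpret cring germ_ring by (rule cring_germ_ring)
  have sub: "{u, v} \<subseteq> carrier germ_ring" using assms by simp
  have "u \<in> ideal2 u v" "v \<in> ideal2 u v"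
    by (auto intro: ideal2I[of 1 0] ideal2I[of 0 1] convergent_series_closed)
  then show "genideal germ_ring {u, v} \<subseteq> ideal2 u v"
    by (intro genideal_minimal ideal_ideal2 assms) auto
  interpret J: ideal "genideal germ_ring {u, v}" germ_ring
    by (rule genideal_ideal[OF sub])
  have "u \<in> genideal germ_ring {u, v}" "v \<in> genideal germ_ring {u, v}"
    using genideal_self[OF sub] by auto
  then show "ideal2 u v \<subseteq> genideal germ_ring {u, v}"
    using J.a_closed J.I_l_closed by (auto simp: ideal2_def)
qed

lemma subfield_const: "subfield (range const) germ_ring"
proof -
  interpret cring germ_ring by (rule cring_germ_ring)
  have sub: "subring (range const) germ_ring"
  proof (rule subringI)
    show "\<one>\<^bsub>germ_ring\<^esub> \<in> range const" by (metis germ_ring_simps(4) const_simps(2) rangeI)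
    show "\<ominus>\<^bsub>germ_ring\<^esub> h \<in> range const" if "h \<in> range const" for h
      using that by (auto simp: a_inv_germ_ring convergent_series_const simp flip: const_simps)
  qed (auto simp: convergent_series_const simp flip: const_simps)
  have "Units (germ_ring\<lparr>carrier := range const\<rparr>) = range const - {0}"
  proof (intro equalityI subsetI)
    fix x assume "x \<in> Units (germ_ring\<lparr>carrier := range const\<rparr>)"
    then show "x \<in> range const - {0}" by (auto simp: Units_def)
  next
    fix x assume "x \<in> range const - {0}"
    then obtain c where c: "x = const c" "c \<noteq> 0" using const_simps(1) by auto
    then have "const (inverse c) * x = 1" by (simp add: const_simps(2) flip: const_simps(6))
    then show "x \<in> Units (germ_ring\<lparr>carrier := range const\<rparr>)"
      using c by (auto simp: Units_def mult.commute)
  qed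
  then show ?thesis
    by (intro subfieldI subcringI' sub) simp
qed

text \<open>The projection turns each \<open>adjoin\<close> into a line extension over the image of
  the scalars. The new class is independent of the old ones because \<open>I\<close> is contained in
  \<open>V\<close> and \<open>v\<close> is outside \<open>V\<close>.\<close>

lemma dimension_of_filtration:
  assumes "subspace_yz I" "ideal I germ_ring" "filtration I n V"
  defines "\<phi> \<equiv> a_r_coset germ_ring I"
  shows "ring.dimension (germ_ring Quot I) n (\<phi> ` range const) (\<phi> ` V)"
proof -
  interpret I: ideal I germ_ring by fact
  interpret cring germ_ring by (rule cring_germ_ring)
  interpret Q: ring "germ_ring Quot I" by (rule I.quotient_is_ring)
  interpret h: ring_hom_ring germ_ring "germ_ring Quot I" \<phi>
    unfolding \<phi>_def by (rule I.rcos_ring_hom_ring)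
  have \<phi>: "\<phi> x = {h + x | h. h \<in> I}" for x
    by (auto simp: \<phi>_def a_r_coset_def')
  have I: "I \<subseteq> convergent_series" "0 \<in> I" using assms(1) by (auto simp: subspace_yz_def)
  show ?thesis
    using assms(3)
  proof induction
    case filtration_0
    have "\<phi> x = \<zero>\<^bsub>germ_ring Quot I\<^esub>" if "x \<in> I" for x
      using that I.a_rcos_const by (simp add: \<phi>_def FactRing_def)
    then have "\<phi> ` I = {\<zero>\<^bsub>germ_ring Quot I\<^esub>}" using I(2) by blast
    then show ?case by simp
  next
    case (filtration_Suc n V v)
    have V: "subspace_yz V" "I \<subseteq> V"
      using filtration_subspace[OF filtration_Suc(1) assms(1)] by auto
    then have VO: "V \<subseteq> convergent_series" by (simp add: subspace_yz_def)
    have "\<phi> v \<notin> \<phi> ` V"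
    proof
      assume "\<phi> v \<in> \<phi> ` V"
      then obtain w where "w \<in> V" "\<phi> v = \<phi> w" by auto
      moreover have "v \<in> \<phi> v" using I(2) by (auto simp: \<phi>)
      ultimately obtain h where "h \<in> I" "v = h + w" by (auto simp: \<phi>)
      then show False
        using V \<open>w \<in> V\<close> filtration_Suc by (auto simp: subspace_yz_def)
    qed
    moreover have "\<phi> ` adjoin v V
        = Q.line_extension (\<phi> ` range const) (\<phi> v) (\<phi> ` V)"
    proof -
      have hom: "\<phi> (const c * v + F)
          = (\<phi> (const c) \<otimes>\<^bsub>germ_ring Quot I\<^esub> \<phi> v) \<oplus>\<^bsub>germ_ring Quot I\<^esub> \<phi> F"
        if "F \<in> V" for c F
      proof -
        have "F \<in> convergent_series" "const c * v \<in> convergent_series"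
          using that VO filtration_Suc(2) by (auto intro: convergent_series_closed)
        then show ?thesis
          using h.hom_add[of "const c * v" F] h.hom_mult[of "const c" v] filtration_Suc(2)
          by (simp add: convergent_series_const)
      qed
      show ?thesis
      proof (intro equalityI subsetI)
        fix x assume "x \<in> \<phi> ` adjoin v V"
        then obtain c F where "x = \<phi> (const c * v + F)" "F \<in> V" by (auto simp: adjoin_def)
        then show "x \<in> Q.line_extension (\<phi> ` range const) (\<phi> v) (\<phi> ` V)"
          unfolding Q.line_extension_mem_iff using hom by blast
      next
        fix x assume "x \<in> Q.line_extension (\<phi> ` range const) (\<phi> v) (\<phi> ` V)"
        then obtain c F where "x = \<phi> (const c * v + F)" "F \<in> V"
          unfolding Q.line_extension_mem_iff using hom by auto
        then show "x \<in> \<phi> ` adjoin v V" by (auto simp: adjoin_def)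
      qed
    qed
    ultimately show ?case
      using Q.Suc_dim[OF _ _ filtration_Suc(4), of "\<phi> v"] filtration_Suc(2) h.hom_closed by simp
  qed
qed

text \<open>Here the description by \<open>THE\<close> is resolved: over a subfield the dimension is
  unique. The condition \<open>n > 0\<close> makes the quotient nonzero, so that the image of the
  scalars is a subfield.\<close>

lemma intersection_index_eq:
  assumes "colength (germ f) (germ g) n" "n > 0"
    and "germ f \<in> convergent_series" "germ g \<in> convergent_series"
  shows "intersection_index f g = enat n"
proof -
  define I where "I = ideal2 (germ f) (germ g)"
  define \<phi> where "\<phi> = a_r_coset germ_ring I"
  have I_eq: "intersection_ideal f g = I"
    by (simp add: intersection_ideal_def I_def genideal_germ_ring assms)
  have filt: "filtration I n convergent_series"
    using assms(1) by (simp add: colength_def I_def)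
  have sub: "subspace_yz I" unfolding I_def by (rule subspace_yz_ideal2) fact+
  interpret I: ideal I germ_ring unfolding I_def by (rule ideal_ideal2) fact+
  interpret cring germ_ring by (rule cring_germ_ring)
  interpret Q: cring "germ_ring Quot I" by (rule I.quotient_is_cring[OF cring_germ_ring])
  interpret h: ring_hom_ring germ_ring "germ_ring Quot I" \<phi>
    unfolding \<phi>_def by (rule I.rcos_ring_hom_ring)
  have carrier: "carrier (germ_ring Quot I) = \<phi> ` convergent_series"
    by (auto simp: FactRing_def A_RCOSETS_def' \<phi>_def)
  have K: "\<phi> ` range const = local_scalars f g"
    unfolding local_scalars_def I_eq \<phi>_def const_def by auto
  have dim: "Q.dimension n (\<phi> ` range const) (carrier (germ_ring Quot I))"
    unfolding carrier \<phi>_def by (rule dimension_of_filtration[OF sub I.ideal_axioms filt])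
  \<comment> \<open>If the quotient were zero, then \<open>I\<close> would be all of
    \<open>O\<close>; but the last step of a nonempty chain adjoins an element outside a subspace
    containing \<open>I\<close>.\<close>
  have "\<one>\<^bsub>germ_ring Quot I\<^esub> \<noteq> \<zero>\<^bsub>germ_ring Quot I\<^esub>"
  proof
    assume "\<one>\<^bsub>germ_ring Quot I\<^esub> = \<zero>\<^bsub>germ_ring Quot I\<^esub>"
    then have "1 \<in> I"
      using I.a_rcos_self[of 1] by (simp add: FactRing_def convergent_series_1)
    then have "convergent_series \<subseteq> I" using I.one_imp_carrier by simp
    from filt this \<open>n > 0\<close> show False
    proof cases
      case (filtration_Suc m V v)
      then show False
        using filtration_subspace[OF filtration_Suc(3) sub] \<open>convergent_series \<subseteq> I\<close> by blast
    qed simp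
  qed
  then have "subfield (\<phi> ` range const) (germ_ring Quot I)"
    by (rule h.img_is_subfield(2)[OF subfield_const])
  then have "m = n" if "Q.dimension m (\<phi> ` range const) (carrier (germ_ring Quot I))" for m
    using Q.dimension_is_inj[OF _ that dim] by blast
  then have "(THE m. Q.dimension m (\<phi> ` range const) (carrier (germ_ring Quot I))) = n"
    using dim by blast
  then show ?thesis
    using dim by (auto simp: intersection_index_def local_algebra_def I_eq K Let_def)
qed

section \<open>Polynomials as germs\<close>

lemma germ_add: "germ (p + q) = germ p + germ q"
  and germ_diff: "germ (p - q) = germ p - germ q"
  and germ_uminus: "germ (- p) = - germ p"
  by (rule fps_ext, rule fps_ext, simp add: germ_def lookup_add lookup_minus)+

lemma germ_single: "germ (Poly_Mapping.single (j, k) c) = const c * Y ^ j * Z ^ k"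
proof (intro fps_ext)
  fix n m
  have "fps_nth (fps_nth (const c * Y ^ j * Z ^ k) n) m = (if n = k \<and> m = j then c else 0)"
    by (simp add: const_def Y_def Z_def fps_const_power fps_X_power_mult_right_nth)
  then show "fps_nth (fps_nth (germ (Poly_Mapping.single (j, k) c)) n) m
      = fps_nth (fps_nth (const c * Y ^ j * Z ^ k) n) m"
    by (auto simp: germ_def lookup_single when_def)
qed

section \<open>Homogenization and lowest degrees\<close>

lemma lookup_homogenize:
  "Poly_Mapping.lookup (homogenize d p) (i, j, k)
     = (if i = d - (j + k) then Poly_Mapping.lookup p (j, k) else 0)"
proof -
  have "Poly_Mapping.lookup (homogenize d p) (i, j, k)
      = (\<Sum>x \<in> Poly_Mapping.keys p.
          if x = (j, k) then (if i = d - (j + k) then Poly_Mapping.lookup p (j, k) else 0) else 0)"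
    unfolding homogenize_def lookup_sum
    by (rule sum.cong) (auto simp: lookup_single when_def split: if_splits)
  also have "\<dots> = (if i = d - (j + k) then Poly_Mapping.lookup p (j, k) else 0)"
    by (simp add: in_keys_iff)
  finally show ?thesis .
qed

text \<open>Setting \<open>x = 1\<close> forgets the exponent of \<open>x\<close>, so the identity
  holds even where \<open>d - (j + k)\<close> is truncated to 0.\<close>

lemma dehomogenize_homogenize: "dehomogenize (homogenize d p) = p"
proof (rule poly_mapping_eqI)
  fix x :: "nat \<times> nat"
  obtain j k where x: "x = (j, k)" by (cases x)
  have "Poly_Mapping.lookup (dehomogenize (homogenize d p)) (j, k)
      = (\<Sum>x \<in> Poly_Mapping.keys (homogenize d p).
          if x = (d - (j + k), j, k) then Poly_Mapping.lookup p (j, k) else 0)"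
    unfolding dehomogenize_def lookup_sum
    by (rule sum.cong)
       (auto simp: lookup_single when_def lookup_homogenize in_keys_iff split: if_splits)
  also have "\<dots> = Poly_Mapping.lookup p (j, k)"
    by (simp add: in_keys_iff lookup_homogenize)
  finally show "Poly_Mapping.lookup (dehomogenize (homogenize d p)) x = Poly_Mapping.lookup p x"
    by (simp add: x)
qed

lemma lookup_homogeneous_part:
  "Poly_Mapping.lookup (homogeneous_part d p) (j, k)
     = (if j + k = d then Poly_Mapping.lookup p (j, k) else 0)"
proof -
  let ?S = "{(j, k). (j, k) \<in> Poly_Mapping.keys p \<and> j + k = d}"
  have "finite ?S" by (rule finite_subset[OF _ finite_keys[of p]]) auto
  have "Poly_Mapping.lookup (homogeneous_part d p) (j, k)
      = (\<Sum>x \<in> ?S. if x = (j, k) then Poly_Mapping.lookup p (j, k) else 0)"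
    unfolding homogeneous_part_def lookup_sum
    by (rule sum.cong) (auto simp: lookup_single when_def)
  also have "\<dots> = (if j + k = d then Poly_Mapping.lookup p (j, k) else 0)"
    using \<open>finite ?S\<close> by (auto simp: in_keys_iff)
  finally show ?thesis .
qed

lemma lookup_eq_0_of_lowest_degree:
  assumes "enat (j + k) < lowest_degree p"
  shows "Poly_Mapping.lookup p (j, k) = 0"
proof (rule ccontr)
  assume "Poly_Mapping.lookup p (j, k) \<noteq> 0"
  then have "Poly_Mapping.lookup (homogeneous_part (j + k) p) (j, k) \<noteq> 0"
    by (simp add: lookup_homogeneous_part)
  then have "homogeneous_part (j + k) p \<noteq> 0" by auto
  then have "lowest_degree p \<le> enat (j + k)"
    unfolding lowest_degree_def by (auto intro: INF_lower)
  then show False using assms by simp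
qed

section \<open>The intersection index\<close>

lemma colength_linear_unit:
  assumes "c \<noteq> 0"
  shows "colength ((const c + const d * Y) * u) v n \<longleftrightarrow> colength u v n"
proof -
  obtain w where "w \<in> convergent_series" "(const c + const d * Y) * w = 1"
    using linear_unit[OF assms] by blast
  then show ?thesis
    by (intro colength_unit) (simp_all add: convergent_series_closed)
qed

lemma colength_const_mult: "c \<noteq> 0 \<Longrightarrow> colength (const c * u) v n \<longleftrightarrow> colength u v n"
  using colength_linear_unit[of c 0] by (simp add: const_simps)

lemma colength_smooth_factor:
  fixes a b e :: complex
  assumes "b \<noteq> 0" "e \<noteq> 0"
  defines "h \<equiv> const a * Y - Y ^ 2 + const b * Z"
    and "g \<equiv> - const a * Y ^ 2 + Y ^ 3 - const (b + 1) * Y * Z - const e * Z ^ 2"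
  shows "colength h g (if a = 0 \<or> e * a = b then 3 else 2)"
proof -
  let ?m = "if a = 0 \<or> e * a = b then 3 else 2 :: nat"
  define p where "p = const (a / b) + const (- (1 / b)) * Y"
  \<comment> \<open>This is \<open>1 - e p\<close>, written as a linear polynomial in
    \<open>y\<close> so that it is visibly a unit when its constant term is nonzero.\<close>
  define q where "q = const (1 - e * (a / b)) + const (e * (1 / b)) * Y"
  define z' where "z' = p * Y + Z"
  have pO: "p \<in> convergent_series" by (simp add: p_def convergent_series_closed)
  have "const b * const (a / b) = const a" "const b * const (1 / b) = 1"
    using assms by (simp_all add: const_simps(2) flip: const_simps(6))
  moreover have "const b * p = const b * const (a / b) - const b * const (1 / b) * Y"
    by (simp add: p_def const_simps algebra_simps)
  ultimately have bp: "const b * p = const a - Y" by simp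
  have q: "q = 1 - const e * p"
    unfolding p_def q_def const_simps by (simp add: algebra_simps)
  \<comment> \<open>Eliminating \<open>a\<close> in this way turns the next two claims into
    polynomial identities in \<open>b\<close>, \<open>e\<close>, \<open>p\<close>, \<open>y\<close>,
    \<open>z\<close>.\<close>
  have ap: "const a = const b * p + Y" by (simp add: bp)
  have h: "h = const b * z'"
    unfolding h_def z'_def ap by (simp add: algebra_simps power2_eq_square)
  \<comment> \<open>Division of \<open>g\<close> by \<open>z' = z + p y\<close> as polynomials in
    \<open>z\<close>; the remainder is the value at \<open>z = - p y\<close>.\<close>
  have g: "g = (- const b * Y - Y - const e * Z + const e * p * Y) * z' + Y ^ 2 * (p * q)"
    unfolding g_def z'_def ap q
    by (simp add: const_simps algebra_simps power2_eq_square power3_eq_cube)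
  have Ym: "colength (Y ^ ?m) z' ?m"
    unfolding z'_def by (rule colength_Y_power[OF pO])
  have "colength (Y ^ 2 * (p * q)) z' ?m"
  \<comment> \<open>The constant terms of \<open>p\<close> and \<open>q\<close> are
    \<open>a / b\<close> and \<open>1 - e a / b\<close>. They never vanish together, so at most one
    of the two factors contributes a further \<open>y\<close> and the other is a unit.\<close>
  proof (cases "a = 0")
    case True
    have "Y ^ 2 * (p * q)
        = const (- (1 / b)) * ((const 1 + const (e * (1 / b)) * Y) * Y ^ 3)"
      unfolding p_def q_def True const_simps
      by (simp add: const_simps algebra_simps power2_eq_square power3_eq_cube)
    then show ?thesis
      using Ym assms True by (simp add: colength_const_mult colength_linear_unit)
  next
    case False
    show ?thesis
    proof (cases "e * a = b")
      case True
      have "Y ^ 2 * (p * q)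
          = const (e * (1 / b)) * ((const (a / b) + const (- (1 / b)) * Y) * Y ^ 3)"
      proof -
        have ea: "e * (a / b) = 1" using True assms by simp
        show ?thesis
          unfolding p_def q_def ea
          by (simp add: const_simps(1) algebra_simps power2_eq_square power3_eq_cube)
      qed
      moreover have "e * (1 / b) \<noteq> 0" "a / b \<noteq> 0" using assms False by auto
      ultimately show ?thesis
        using Ym True by (simp add: colength_const_mult colength_linear_unit)
    next
      case neq: False
      have eq: "Y ^ 2 * (p * q) = (const (a / b) + const (- (1 / b)) * Y)
          * ((const (1 - e * (a / b)) + const (e * (1 / b)) * Y) * Y ^ 2)"
        by (simp add: p_def q_def mult_ac)
      have nz: "a / b \<noteq> 0" "1 - e * (a / b) \<noteq> 0"
        using assms False neq by (auto simp: field_simps)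
      show ?thesis
        unfolding eq colength_linear_unit[OF nz(1)] colength_linear_unit[OF nz(2)]
        using Ym False neq by simp
    qed
  qed
  then have "colength z' g ?m"
    unfolding g using pO
    by (subst colength_add_multiple)
       (auto simp: z'_def colength_commute intro!: convergent_series_closed)
  then show ?thesis
    unfolding h colength_const_mult[OF \<open>b \<noteq> 0\<close>] .
qed

text \<open>Each value is the contribution of the line \<open>z = 0\<close>, which is 3 or 2, plus
  that of the remaining factor \<open>h\<close>: 7 = 3 + 4, 6 = 3 + 3, 5 = 2 + 3, 4 = 2 + 2.\<close>

lemma colength_form:
  fixes a b e :: complex
  assumes "e \<noteq> 0"
  defines "f \<equiv> Z * (const a * Y - Y ^ 2 + const b * Z)"
    and "g \<equiv> - const a * Y ^ 2 + Y ^ 3 - const (b + 1) * Y * Z - const e * Z ^ 2"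
  shows "colength f g
    (if b = 0 then if a = 0 then 7 else 4 else if a = 0 then 6 else if e * a = b then 5 else 4)"
proof -
  define h where "h = const a * Y - Y ^ 2 + const b * Z"
  have hO: "h \<in> convergent_series" and gO: "g \<in> convergent_series"
    by (simp_all add: h_def g_def convergent_series_closed)
  have line: "colength Z g (if a = 0 then 3 else 2)"
  proof -
    \<comment> \<open>Modulo \<open>z\<close> only \<open>- a y^2 + y^3 = (y - a) y^2\<close> is
      left, of order 3 or 2 according to whether \<open>a\<close> vanishes.\<close>
    have g: "g = (- const (b + 1) * Y - const e * Z) * Z + (- const a * Y ^ 2 + Y ^ 3)"
      by (simp add: g_def algebra_simps power2_eq_square)
    have "colength (- const a * Y ^ 2 + Y ^ 3) Z (if a = 0 then 3 else 2)"
    proof (cases "a = 0")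
      case True
      then show ?thesis
        using colength_Y_power[OF convergent_series_0, of 3] by (simp add: const_simps)
    next
      case False
      have "- const a * Y ^ 2 + Y ^ 3 = (const (- a) + const 1 * Y) * Y ^ 2"
        by (simp add: const_simps algebra_simps power2_eq_square power3_eq_cube)
      then show ?thesis
        using colength_Y_power[OF convergent_series_0, of 2] False
        by (simp add: colength_linear_unit)
    qed
    then show ?thesis
      unfolding g
      by (subst colength_add_multiple) (auto simp: colength_commute intro!: convergent_series_closed)
  qed
  have Yg: "colength Y g 2"
  proof -
    \<comment> \<open>Modulo \<open>y\<close> only \<open>- e z^2\<close> is left;
      \<open>e \<noteq> 0\<close> makes its order exactly 2.\<close>
    have g: "g = (- const a * Y + Y ^ 2 - const (b + 1) * Z) * Y + const (- e) * Z ^ 2"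
      by (simp add: g_def const_simps algebra_simps power2_eq_square power3_eq_cube)
    have "colength (const (- e) * Z ^ 2) Y 2"
      using colength_Z_square \<open>e \<noteq> 0\<close> by (simp add: colength_const_mult)
    then show ?thesis
      unfolding g
      by (subst colength_add_multiple) (auto simp: colength_commute intro!: convergent_series_closed)
  qed
  have "colength h g
    (if b = 0 then if a = 0 then 4 else 2 else if a = 0 \<or> e * a = b then 3 else 2)"
  proof (cases "b = 0")
    case False
    then show ?thesis
      using colength_smooth_factor[OF False assms(1), of a] by (simp add: h_def g_def)
  next
    case b: True
    show ?thesis
    proof (cases "a = 0")
      case True
      \<comment> \<open>In this case \<open>h = - y^2\<close> is a double line, so the index 2 of
        \<open>y\<close> and \<open>g\<close> is counted twice. Additivity applies because the
        coefficient of \<open>z^2\<close> in \<open>g(0, z)\<close> is \<open>- e\<close>.\<close>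
      have "restrict_Y0 g \<noteq> 0"
      proof
        assume "restrict_Y0 g = 0"
        then have "fps_nth (restrict_Y0 g) 2 = 0" by simp
        then show False
          using assms(1) by (simp add: restrict_Y0_def g_def const_def Y_def Z_def fps_const_power True b)
      qed
      then have "colength (Y * Y) g (2 + 2)"
        by (intro colength_mult Yg gO coprime_mod_Y) (auto simp: convergent_series_closed Y_Z_neq_0)
      moreover have "h = const (-1) * (Y * Y)"
        by (simp add: h_def b True const_simps power2_eq_square)
      ultimately show ?thesis
        using True b by (simp add: colength_const_mult)
    next
      case False
      have "h = (const a + const (-1) * Y) * Y"
        by (simp add: h_def b const_simps algebra_simps power2_eq_square)
      then show ?thesis
        using False b Yg by (simp add: colength_linear_unit)
    qed
  qed
  moreover have "coprime_mod Z g"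
  proof (rule coprime_mod_Z[OF gO])
    \<comment> \<open>The coefficient of \<open>y^3\<close> in \<open>g(y, 0)\<close> is 1 whatever
      \<open>a\<close> is, so \<open>z\<close> never divides \<open>g\<close>.\<close>
    have "fps_nth (fps_nth g 0) 3 = 1"
      by (simp add: g_def const_def Y_def Z_def fps_const_power)
    then show "fps_nth g 0 \<noteq> 0" by auto
  qed
  ultimately have "colength (Z * h) g
      ((if b = 0 then if a = 0 then 4 else 2 else if a = 0 \<or> e * a = b then 3 else 2)
        + (if a = 0 then 3 else 2))"
    by (intro colength_mult line hO gO) (auto simp: convergent_series_closed Y_Z_neq_0)
  then show ?thesis
    by (auto simp: f_def h_def split: if_splits)
qed

theorem theorem5p4:
  fixes C21_10 C21_01 C30_10 C30_20 C30_01 C30_11 C30_02 :: complex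
    and f g :: poly_yz and A :: poly_xyz and \<omega> :: one_form
  assumes "C30_02 \<noteq> 0"
    and "f = - cst C21_10 * y_var - cst C21_01 * z_var + cst C30_20 * y_var * z_var
             - y_var ^ 2 * z_var + cst (C30_11 - 1) * z_var ^ 2"
    and "g = - cst C30_10 * y_var - cst C30_20 * y_var ^ 2 + y_var ^ 3 - cst C30_01 * z_var
             - cst C30_11 * y_var * z_var - cst C30_02 * z_var ^ 2"
    and "\<omega> = (A, homogenize 3 f, homogenize 3 g)"
    and "projective_form 3 \<omega>"
    and "alg_multiplicity_100 \<omega> = 2"
  shows "4 \<le> intersection_index f g \<and> intersection_index f g \<le> 7 \<and>
         (intersection_index f g = 7 \<longleftrightarrow> C30_20 = 0 \<and> C30_11 = 1)"
proof -
  let ?s = "\<lambda>j k c. Poly_Mapping.single (j, k) c :: poly_yz"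
  \<comment> \<open>Expansion into monomials, so that the linear coefficients can be read
    off.\<close>
  have f: "f = - ?s 1 0 C21_10 - ?s 0 1 C21_01 + ?s 1 1 C30_20 - ?s 2 1 1 + ?s 0 2 (C30_11 - 1)"
    by (simp add: assms(2) mult_single power2_eq_square zero_prod_def numeral_2_eq_2)
  have g: "g = - ?s 1 0 C30_10 - ?s 2 0 C30_20 + ?s 3 0 1 - ?s 0 1 C30_01 - ?s 1 1 C30_11
      - ?s 0 2 C30_02"
    by (simp add: assms(3) mult_single power2_eq_square power3_eq_cube zero_prod_def
        numeral_2_eq_2 numeral_3_eq_3)
  have "min (lowest_degree f) (lowest_degree g) = 2"
    using assms(6) by (simp add: assms(4) alg_multiplicity_100_def dehomogenize_homogenize)
  \<comment> \<open>Multiplicity 2 keeps both lowest degrees above 1, which forces all four linear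
    coefficients to vanish.\<close>
  then have "enat 1 < lowest_degree f" "enat 1 < lowest_degree g"
    by (metis enat_ord_simps(2) min.strict_boundedE numeral_eq_enat one_less_numeral_iff semiring_norm(76))+
  then have "Poly_Mapping.lookup f (1, 0) = 0" "Poly_Mapping.lookup f (0, 1) = 0"
    "Poly_Mapping.lookup g (1, 0) = 0" "Poly_Mapping.lookup g (0, 1) = 0"
    by (auto intro!: lookup_eq_0_of_lowest_degree)
  then have lin: "C21_10 = 0" "C21_01 = 0" "C30_10 = 0" "C30_01 = 0"
    by (auto simp: f g lookup_add lookup_minus lookup_single when_def)
  let ?b = "C30_11 - 1"
  have gf: "germ f = Z * (const C30_20 * Y - Y ^ 2 + const ?b * Z)"
    by (simp add: f lin germ_add germ_diff germ_uminus germ_single const_simps algebra_simps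
        power2_eq_square)
  have gg: "germ g = - const C30_20 * Y ^ 2 + Y ^ 3 - const (?b + 1) * Y * Z - const C30_02 * Z ^ 2"
    by (simp add: g lin germ_add germ_diff germ_uminus germ_single const_simps algebra_simps)
  \<comment> \<open>The possible values are 4, 5, 6 and 7, and 7 occurs exactly in the branch where
    \<open>C30_20\<close> and \<open>C30_11 - 1\<close> are both zero.\<close>
  have "intersection_index f g = enat (if ?b = 0 then if C30_20 = 0 then 7 else 4
      else if C30_20 = 0 then 6 else if C30_02 * C30_20 = ?b then 5 else 4)"
    using colength_form[OF assms(1), of C30_20 ?b]
    by (intro intersection_index_eq) (auto simp: gf gg convergent_series_closed)
  then show ?thesis
    by (auto simp: numeral_eq_enat)
qed

end
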